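(* Let $G$ be a vertex decomposable graph on vertex set $\{x_1,\ldots,x_n\}$ and let $s_1,\ldots,s_n$ be integers with $s_i\ge 2$ for $1\le i\le n$. Then the graph expansion $G^{(s_1,\ldots,s_n)}$ is vertex decomposable and $\mathrm{Shed}(G^{(s_1,\ldots,s_n)})$ is a dominating set of $G^{(s_1,\ldots,s_n)}$.
   Context: For a graph $G$ on $\{x_1,\ldots,x_n\}$ and positive integers $s_1,\ldots,s_n$, the graph expansion $G^{(s_1,\ldots,s_n)}$ has vertex set $\{x_{i,j}: 1\le i\le n,\ 1\le j\le s_i\}$ and edge set $\{\{x_{i,j},x_{k,l}\}: \{x_i,x_k\}\in E(G)\text{ or } i=k\}$ (with $(i,j)\ne(k,l)$). All graphs are finite and simple. For a graph $G=(V,E)$ and $x\in V$, $G\setminus x$ is the graph obtained by deleting $x$ and its incident edges; $N[x]$ is $x$ together with its neighbours, and $G\setminus N[x]$ is obtained by deleting all vertices of $N[x]$ and their incident edges. A graph is well-covered if all its maximal independent sets have the same cardinality. A graph $G$ is vertex decomposable if $G$ is well-covered and either (i) $G$ has no edges (possibly no vertices), or (ii) there is a vertex $x$ such that both $G\setminus x$ and $G\setminus N[x]$ are vertex decomposable. For a vertex decomposable graph $G$, $\mathrm{Shed}(G)$ is the set of vertices $x$ such that $G\setminus x$ and $G\setminus N[x]$ are both vertex decomposable. A set $D\subseteq V$ is dominating if every vertex of $V\setminus D$ is adjacent to a vertex of $D$. *)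

theory Defs
  imports "Graph_Theory.Graph_Theory"
begin

text \<open>
  Finite simple graphs are the members of the locale \<^locale>\<open>graph\<close>: an undirected
  edge is represented by the two opposite arcs between its endpoints. The family
  $s_1, \ldots, s_n$ is represented by a function \<open>s\<close> on the vertices.
\<close>

definition closed_nbhd :: "('a, 'b) pre_digraph \<Rightarrow> 'a \<Rightarrow> 'a set" where
  "closed_nbhd G x = insert x {y \<in> verts G. x \<rightarrow>\<^bsub>G\<^esub> y}"

definition del_closed_nbhd :: "('a, 'b) pre_digraph \<Rightarrow> 'a \<Rightarrow> ('a, 'b) pre_digraph" where
  "del_closed_nbhd G x = G \<restriction> (verts G - closed_nbhd G x)"

definition indep_set :: "('a, 'b) pre_digraph \<Rightarrow> 'a set \<Rightarrow> bool" where
  "indep_set G A \<longleftrightarrow> A \<subseteq> verts G \<and> (\<forall>u\<in>A. \<forall>v\<in>A. \<not> u \<rightarrow>\<^bsub>G\<^esub> v)"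

definition maximal_indep_set :: "('a, 'b) pre_digraph \<Rightarrow> 'a set \<Rightarrow> bool" where
  "maximal_indep_set G A \<longleftrightarrow> indep_set G A \<and> (\<forall>B. indep_set G B \<and> A \<subseteq> B \<longrightarrow> B = A)"

definition well_covered :: "('a, 'b) pre_digraph \<Rightarrow> bool" where
  "well_covered G \<longleftrightarrow>
     (\<forall>A B. maximal_indep_set G A \<and> maximal_indep_set G B \<longrightarrow> card A = card B)"

inductive vertex_decomposable :: "('a, 'b) pre_digraph \<Rightarrow> bool" where
  no_edges: "well_covered G \<Longrightarrow> arcs G = {} \<Longrightarrow> vertex_decomposable G"
| shedding: "well_covered G \<Longrightarrow> x \<in> verts G \<Longrightarrow>
    vertex_decomposable (pre_digraph.del_vert G x) \<Longrightarrow>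
    vertex_decomposable (del_closed_nbhd G x) \<Longrightarrow> vertex_decomposable G"

definition Shed :: "('a, 'b) pre_digraph \<Rightarrow> 'a set" where
  "Shed G = {x \<in> verts G. vertex_decomposable (pre_digraph.del_vert G x) \<and>
     vertex_decomposable (del_closed_nbhd G x)}"

definition dominating_set :: "('a, 'b) pre_digraph \<Rightarrow> 'a set \<Rightarrow> bool" where
  "dominating_set G D \<longleftrightarrow> D \<subseteq> verts G \<and> (\<forall>v \<in> verts G - D. \<exists>u\<in>D. v \<rightarrow>\<^bsub>G\<^esub> u)"

definition expansion_verts :: "('a, 'b) pre_digraph \<Rightarrow> ('a \<Rightarrow> nat) \<Rightarrow> ('a \<times> nat) set" where
  "expansion_verts G s = (SIGMA x : verts G. {1..s x})"

definition graph_expansion ::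
  "('a, 'b) pre_digraph \<Rightarrow> ('a \<Rightarrow> nat) \<Rightarrow> ('a \<times> nat, ('a \<times> nat) \<times> ('a \<times> nat)) pre_digraph"
  where
  "graph_expansion G s =
     \<lparr> verts = expansion_verts G s,
       arcs = {(p, q). p \<in> expansion_verts G s \<and> q \<in> expansion_verts G s \<and> p \<noteq> q \<and>
                 (fst p \<rightarrow>\<^bsub>G\<^esub> fst q \<or> fst p = fst q)},
       tail = fst, head = snd \<rparr>"

lemma graph_graph_expansion:
  assumes "graph G"
  shows "graph (graph_expansion G s)"
proof -
  interpret graph G by fact
  have fin: "finite (expansion_verts G s)"
    by (simp add: expansion_verts_def)
  have "arcs (graph_expansion G s) \<subseteq> expansion_verts G s \<times> expansion_verts G s"
    by (auto simp: graph_expansion_def)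
  then have "finite (arcs (graph_expansion G s))"
    using fin by (meson finite_SigmaI finite_subset)
  moreover have "symmetric (graph_expansion G s)"
    using arcs_ends_symmetric[OF sym_arcs]
    by (auto simp: symmetric_conv graph_expansion_def)
  ultimately show ?thesis
    using fin by unfold_locales (auto simp: graph_expansion_def arc_to_ends_def)
qed

end

theory Submission
  imports Defs
begin

text \<open>
  Vertex decomposability passes to \<open>G \<setminus> N[x]\<close> for every vertex \<open>x\<close>, whether or not \<open>x\<close> is
  shedding. If \<open>s x \<ge> 2\<close>, deleting the last copy \<open>(x, s x)\<close> from the expansion
  lowers \<open>s x\<close> by one, while deleting its closed neighbourhood gives the expansion of
  \<open>G \<setminus> N[x]\<close>. Hence, by induction on the number of vertices, all expansions with positive
  multiplicities are vertex decomposable (when all multiplicities are one, the shedding vertex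
  of \<open>G\<close> is used). If all multiplicities are at least two, then every last copy \<open>(x, s x)\<close> is
  shedding, and these vertices dominate because the copies of \<open>x\<close> form a clique.
\<close>

section \<open>Induced subgraphs and vertex deletions\<close>

lemma dominates_induce_subgraph_iff:
  "u \<rightarrow>\<^bsub>G \<restriction> W\<^esub> v \<longleftrightarrow> u \<rightarrow>\<^bsub>G\<^esub> v \<and> u \<in> W \<and> v \<in> W"
  by (auto simp: arcs_ends_def arc_to_ends_def)

lemma induce_subgraph_induce_subgraph:
  "W' \<subseteq> W \<Longrightarrow> (G \<restriction> W) \<restriction> W' = G \<restriction> W'"
  by (auto simp: induce_subgraph_def)

lemma (in wf_digraph) del_vert_eq_induce_subgraph:
  "del_vert x = G \<restriction> (verts G - {x})"
  by (auto simp: del_vert_def induce_subgraph_def)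

lemma graph_induce_subgraph:
  assumes "graph G" "W \<subseteq> verts G"
  shows "graph (G \<restriction> W)"
proof -
  interpret graph G by fact
  have "symmetric (G \<restriction> W)"
    unfolding symmetric_def
    by (rule symI, unfold dominates_induce_subgraph_iff)
      (use arcs_ends_symmetric[OF sym_arcs] in blast)
  moreover have "finite W" using assms(2) finite_verts finite_subset by blast
  ultimately show ?thesis
    by unfold_locales (auto simp: no_loops arc_to_ends_def intro: no_multi_arcs)
qed

lemma graph_dominates_sym: "graph G \<Longrightarrow> u \<rightarrow>\<^bsub>G\<^esub> v \<Longrightarrow> v \<rightarrow>\<^bsub>G\<^esub> u"
  by (simp add: arcs_ends_symmetric graph_def pseudo_graph_def sym_digraph.sym_arcs)

lemma graph_not_dominates_self: "graph G \<Longrightarrow> \<not> u \<rightarrow>\<^bsub>G\<^esub> u"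
  by (auto simp: arcs_ends_def arc_to_ends_def graph_def digraph_def
      dest: loopfree_digraph.no_loops)

lemma graph_dominates_in_verts:
  assumes "graph G" "u \<rightarrow>\<^bsub>G\<^esub> v"
  shows "u \<in> verts G" "v \<in> verts G"
proof -
  interpret graph G by fact
  show "u \<in> verts G" "v \<in> verts G"
    using assms(2) by (auto simp: adj_in_verts)
qed

lemma graph_finite_verts: "graph G \<Longrightarrow> finite (verts G)"
  by (simp add: digraph_def fin_digraph.finite_verts graph_def)

lemma graph_closed_nbhd_iff:
  "graph G \<Longrightarrow> y \<in> closed_nbhd G x \<longleftrightarrow> y = x \<or> x \<rightarrow>\<^bsub>G\<^esub> y"
  by (auto simp: closed_nbhd_def dest: graph_dominates_in_verts)

text \<open>Deletions are rewritten as induced subgraphs of one ambient graph, so that deletions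
  carried out in different orders can be compared through their vertex sets alone.\<close>

lemma del_vert_induce_subgraph:
  "pre_digraph.del_vert (G \<restriction> W) x = G \<restriction> (W - {x})"
  by (auto simp: pre_digraph.del_vert_def induce_subgraph_def)

lemma graph_del_vert_eq_induce_subgraph:
  "graph G \<Longrightarrow> pre_digraph.del_vert G x = G \<restriction> (verts G - {x})"
  by (simp add: digraph_def fin_digraph_def graph_def wf_digraph.del_vert_eq_induce_subgraph)

text \<open>Passing to the subgraph induced on \<open>W\<close> removes from the closed
  neighbourhood of \<open>x\<close> only vertices outside \<open>W\<close>, and these do not affect
  the difference with \<open>W\<close>.\<close>

lemma del_closed_nbhd_induce_subgraph:
  assumes "x \<in> W" "W \<subseteq> verts G"
  shows "del_closed_nbhd (G \<restriction> W) x = G \<restriction> (W - closed_nbhd G x)"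
proof -
  have "W - closed_nbhd (G \<restriction> W) x = W - closed_nbhd G x"
    unfolding closed_nbhd_def dominates_induce_subgraph_iff using assms by auto
  then show ?thesis
    unfolding del_closed_nbhd_def
    by (simp add: induce_subgraph_induce_subgraph)
qed

lemma graph_del_vert: "graph G \<Longrightarrow> graph (pre_digraph.del_vert G x)"
  by (simp add: graph_del_vert_eq_induce_subgraph graph_induce_subgraph)

lemma graph_del_closed_nbhd: "graph G \<Longrightarrow> graph (del_closed_nbhd G x)"
  by (simp add: del_closed_nbhd_def graph_induce_subgraph)

section \<open>Deleting closed neighbourhoods\<close>

lemma maximal_indep_set_iff:
  assumes "graph G"
  shows "maximal_indep_set G A \<longleftrightarrow>
    indep_set G A \<and> (\<forall>v\<in>verts G - A. \<exists>u\<in>A. u \<rightarrow>\<^bsub>G\<^esub> v)"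
proof (intro iffI conjI ballI)
  assume max: "maximal_indep_set G A"
  then show ind: "indep_set G A" by (simp add: maximal_indep_set_def)
  fix v assume v: "v \<in> verts G - A"
  then have "insert v A \<noteq> A" by auto
  then have "\<not> indep_set G (insert v A)"
    using max unfolding maximal_indep_set_def by blast
  then show "\<exists>u\<in>A. u \<rightarrow>\<^bsub>G\<^esub> v"
    using ind v graph_dominates_sym[OF assms] graph_not_dominates_self[OF assms]
    unfolding indep_set_def by blast
next
  assume "indep_set G A \<and> (\<forall>v\<in>verts G - A. \<exists>u\<in>A. u \<rightarrow>\<^bsub>G\<^esub> v)"
  then show "maximal_indep_set G A"
    unfolding maximal_indep_set_def indep_set_def by blast
qed

text \<open>Adding \<open>x\<close> to a maximal independent set of the smaller graph gives one of
  \<open>G\<close>. All cardinalities thus shift by exactly one, and equality carries over.\<close>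

lemma well_covered_del_closed_nbhd:
  assumes G: "graph G" and wc: "well_covered G" and x: "x \<in> verts G"
  shows "well_covered (del_closed_nbhd G x)"
proof -
  have ext: "maximal_indep_set G (insert x A) \<and> card (insert x A) = Suc (card A)"
    if A: "maximal_indep_set (del_closed_nbhd G x) A" for A
  proof
    have sub: "A \<subseteq> verts G - closed_nbhd G x"
      using A by (simp add: maximal_indep_set_def indep_set_def del_closed_nbhd_def)
    then have nadj: "\<not> x \<rightarrow>\<^bsub>G\<^esub> a" "\<not> a \<rightarrow>\<^bsub>G\<^esub> x" "a \<noteq> x" if "a \<in> A" for a
      using that graph_closed_nbhd_iff[OF G] graph_dominates_sym[OF G] by blast+
    have "indep_set G A"
      using A sub unfolding maximal_indep_set_def indep_set_def del_closed_nbhd_def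
        dominates_induce_subgraph_iff by blast
    then have ind: "indep_set G (insert x A)"
      using x nadj graph_not_dominates_self[OF G] unfolding indep_set_def by blast
    \<comment> \<open>Vertices of \<open>N[x]\<close> are dominated by \<open>x\<close>, all others
      by \<open>A\<close>, which is maximal in the smaller graph.\<close>
    have "\<exists>u\<in>insert x A. u \<rightarrow>\<^bsub>G\<^esub> v" if v: "v \<in> verts G - insert x A" for v
    proof (cases "v \<in> closed_nbhd G x")
      case True
      then show ?thesis using v graph_closed_nbhd_iff[OF G] by blast
    next
      case False
      then have "v \<in> verts (del_closed_nbhd G x) - A"
        using v by (simp add: del_closed_nbhd_def)
      then have "\<exists>u\<in>A. u \<rightarrow>\<^bsub>del_closed_nbhd G x\<^esub> v"
        using A maximal_indep_set_iff[OF graph_del_closed_nbhd[OF G]] by blast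
      then show ?thesis
        unfolding del_closed_nbhd_def dominates_induce_subgraph_iff by blast
    qed
    with ind show "maximal_indep_set G (insert x A)"
      using maximal_indep_set_iff[OF G] by blast
    have "finite A" using sub graph_finite_verts[OF G] finite_subset by blast
    then show "card (insert x A) = Suc (card A)"
      using nadj(3) by (auto simp: card_insert_if)
  qed
  show ?thesis
    unfolding well_covered_def
  proof (intro allI impI, elim conjE)
    fix A B
    assume "maximal_indep_set (del_closed_nbhd G x) A" "maximal_indep_set (del_closed_nbhd G x) B"
    then show "card A = card B"
      using ext wc unfolding well_covered_def by (metis Suc_inject)
  qed
qed

text \<open>Induction on the derivation, with shedding vertex \<open>y\<close>. The case
  \<open>x = y\<close> is immediate. If \<open>y\<close> is a neighbour of \<open>x\<close>,
  deleting \<open>y\<close> first changes nothing. Otherwise \<open>y\<close> survives and is a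
  shedding vertex of \<open>G - N[x]\<close>, because the deletions for \<open>x\<close> and
  \<open>y\<close> commute.\<close>

lemma vertex_decomposable_del_closed_nbhd:
  assumes "vertex_decomposable G" "graph G" "x \<in> verts G"
  shows "vertex_decomposable (del_closed_nbhd G x)"
  using assms
proof (induction arbitrary: x rule: vertex_decomposable.induct)
  case (no_edges G)
  then have "arcs (del_closed_nbhd G x) = {}" by (simp add: del_closed_nbhd_def)
  with no_edges show ?case
    by (intro vertex_decomposable.no_edges well_covered_del_closed_nbhd)
next
  case (shedding G y)
  note G = \<open>graph G\<close>
  have delv: "pre_digraph.del_vert G y = G \<restriction> (verts G - {y})"
    by (rule graph_del_vert_eq_induce_subgraph[OF G])
  \<comment> \<open>The induction hypothesis for \<open>G - y\<close>, read inside \<open>G\<close>;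
    it serves both cases with \<open>x \<noteq> y\<close>.\<close>
  have vert: "vertex_decomposable (G \<restriction> (verts G - {y} - closed_nbhd G x))" if "x \<noteq> y"
    using shedding.IH(1)[of x] that shedding.prems graph_del_vert[OF G, of y]
      del_closed_nbhd_induce_subgraph[of x "verts G - {y}" G]
    unfolding delv by auto
  consider "x = y" | "x \<noteq> y" "x \<rightarrow>\<^bsub>G\<^esub> y" | "x \<noteq> y" "\<not> x \<rightarrow>\<^bsub>G\<^esub> y" by blast
  then show ?case
  proof cases
    case 1
    then show ?thesis using shedding by simp
  next
    case 2
    then have "verts G - {y} - closed_nbhd G x = verts G - closed_nbhd G x"
      using graph_closed_nbhd_iff[OF G] by blast
    then show ?thesis using vert[OF 2(1)] by (simp add: del_closed_nbhd_def)
  next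
    case 3
    let ?W = "verts G - closed_nbhd G x"
    have y: "y \<in> ?W"
      using 3 shedding.hyps(2) by (simp add: graph_closed_nbhd_iff[OF G])
    have x: "x \<in> verts G - closed_nbhd G y"
      using 3 shedding.prems(2) graph_dominates_sym[OF G, of y x]
      by (auto simp: graph_closed_nbhd_iff[OF G])
    \<comment> \<open>Both orders of deletion induce the subgraph on the vertices outside
      \<open>N[x]\<close> and \<open>N[y]\<close>.\<close>
    have "vertex_decomposable (del_closed_nbhd (del_closed_nbhd G y) x)"
      using shedding.IH(2)[OF graph_del_closed_nbhd[OF G]] x by (simp add: del_closed_nbhd_def)
    also have "del_closed_nbhd (del_closed_nbhd G y) x = G \<restriction> (?W - closed_nbhd G y)"
      unfolding del_closed_nbhd_def[of G y]
      by (subst del_closed_nbhd_induce_subgraph[OF x])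
        (auto simp: Diff_eq Int_ac)
    also have "\<dots> = del_closed_nbhd (del_closed_nbhd G x) y"
      unfolding del_closed_nbhd_def[of G x]
      by (subst del_closed_nbhd_induce_subgraph[OF y]) auto
    finally have link: "vertex_decomposable (del_closed_nbhd (del_closed_nbhd G x) y)" .
    have "?W - {y} = verts G - {y} - closed_nbhd G x" by blast
    then have "vertex_decomposable (pre_digraph.del_vert (del_closed_nbhd G x) y)"
      using vert[OF 3(1)] by (simp add: del_closed_nbhd_def del_vert_induce_subgraph)
    moreover have "y \<in> verts (del_closed_nbhd G x)"
      using y by (simp add: del_closed_nbhd_def)
    moreover have "well_covered (del_closed_nbhd G x)"
      by (rule well_covered_del_closed_nbhd[OF G shedding.hyps(1) shedding.prems(2)])
    ultimately show ?thesis
      using link by (blast intro: vertex_decomposable.shedding)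
  qed
qed

section \<open>Deletions and maximal independent sets in expansions\<close>

lemma verts_graph_expansion:
  "p \<in> verts (graph_expansion G s) \<longleftrightarrow> fst p \<in> verts G \<and> 1 \<le> snd p \<and> snd p \<le> s (fst p)"
  by (cases p) (auto simp: graph_expansion_def expansion_verts_def)

lemma dominates_graph_expansion_iff:
  "p \<rightarrow>\<^bsub>graph_expansion G s\<^esub> q \<longleftrightarrow>
    p \<in> verts (graph_expansion G s) \<and> q \<in> verts (graph_expansion G s) \<and> p \<noteq> q \<and>
    (fst p \<rightarrow>\<^bsub>G\<^esub> fst q \<or> fst p = fst q)"
  by (auto simp: graph_expansion_def arcs_ends_def arc_to_ends_def image_iff)

text \<open>The arcs of an expansion are pairs of its vertices, so only adjacency in the base graph
  matters and the records are literally equal. This covers both lowering multiplicities and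
  shrinking the base graph.\<close>

lemma graph_expansion_eq_induce_subgraphI:
  assumes "\<And>x. x \<in> verts G' \<Longrightarrow> x \<in> verts G"
    and "\<And>x y. x \<in> verts G' \<Longrightarrow> y \<in> verts G' \<Longrightarrow> x \<rightarrow>\<^bsub>G'\<^esub> y \<longleftrightarrow> x \<rightarrow>\<^bsub>G\<^esub> y"
    and "\<And>x. x \<in> verts G' \<Longrightarrow> s' x \<le> s x"
  shows "graph_expansion G s \<restriction> verts (graph_expansion G' s') = graph_expansion G' s'"
proof -
  have sub: "p \<in> expansion_verts G s" if "p \<in> expansion_verts G' s'" for p
    using that assms(1,3) by (cases p) (force simp: expansion_verts_def)
  have adj: "fst p \<rightarrow>\<^bsub>G'\<^esub> fst q \<longleftrightarrow> fst p \<rightarrow>\<^bsub>G\<^esub> fst q"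
    if "p \<in> expansion_verts G' s'" "q \<in> expansion_verts G' s'" for p q
    using that by (intro assms(2)) (auto simp: expansion_verts_def)
  show ?thesis
    using sub adj by (auto simp: induce_subgraph_def graph_expansion_def)
qed

text \<open>The last copy is chosen because the remaining indices again form an initial segment;
  deleting another copy would give an expansion only up to isomorphism.\<close>

lemma del_vert_graph_expansion_last:
  assumes G: "graph G" and "x \<in> verts G" "s x \<ge> 1"
  shows "pre_digraph.del_vert (graph_expansion G s) (x, s x) = graph_expansion G (s(x := s x - 1))"
proof -
  have "verts (graph_expansion G s) - {(x, s x)} = verts (graph_expansion G (s(x := s x - 1)))"
    using assms by (auto simp: verts_graph_expansion split: if_splits)
  then show ?thesis
    by (simp add: graph_del_vert_eq_induce_subgraph[OF graph_graph_expansion[OF G]]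
        graph_expansion_eq_induce_subgraphI)
qed

lemma del_vert_graph_expansion_only:
  assumes G: "graph G" and "x \<in> verts G" "s x = 1"
  shows "pre_digraph.del_vert (graph_expansion G s) (x, 1)
    = graph_expansion (pre_digraph.del_vert G x) s"
proof -
  have "verts (graph_expansion G s) - {(x, 1)} = verts (graph_expansion (pre_digraph.del_vert G x) s)"
    using assms by (auto simp: verts_graph_expansion pre_digraph.verts_del_vert)
  moreover have "graph_expansion G s \<restriction> verts (graph_expansion (pre_digraph.del_vert G x) s)
      = graph_expansion (pre_digraph.del_vert G x) s"
    unfolding graph_del_vert_eq_induce_subgraph[OF G]
    by (rule graph_expansion_eq_induce_subgraphI)
      (unfold dominates_induce_subgraph_iff, auto)
  ultimately show ?thesis
    by (simp add: graph_del_vert_eq_induce_subgraph[OF graph_graph_expansion[OF G]])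
qed

text \<open>The closed neighbourhood of any copy of \<open>x\<close> consists of all copies of all
  vertices of \<open>N[x]\<close>, independently of \<open>j\<close>.\<close>

lemma del_closed_nbhd_graph_expansion:
  assumes G: "graph G" and "(x, j) \<in> verts (graph_expansion G s)"
  shows "del_closed_nbhd (graph_expansion G s) (x, j) = graph_expansion (del_closed_nbhd G x) s"
proof -
  have "verts (graph_expansion G s) - closed_nbhd (graph_expansion G s) (x, j)
      = verts (graph_expansion (del_closed_nbhd G x) s)"
    using assms(2)
    by (auto simp: graph_closed_nbhd_iff[OF graph_graph_expansion[OF G]]
        graph_closed_nbhd_iff[OF G] del_closed_nbhd_def
        dominates_graph_expansion_iff verts_graph_expansion)
  moreover have "graph_expansion G s \<restriction> verts (graph_expansion (del_closed_nbhd G x) s)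
      = graph_expansion (del_closed_nbhd G x) s"
    unfolding del_closed_nbhd_def
    by (rule graph_expansion_eq_induce_subgraphI)
      (unfold dominates_induce_subgraph_iff, auto)
  ultimately show ?thesis
    by (simp add: del_closed_nbhd_def[of "graph_expansion G s"])
qed

text \<open>The copies of a vertex form a clique, so an independent set contains at most one of them
  and \<open>fst\<close> is injective on it.\<close>

lemma maximal_indep_set_graph_expansion:
  assumes G: "graph G" and s: "\<And>x. x \<in> verts G \<Longrightarrow> s x \<ge> 1"
    and A: "maximal_indep_set (graph_expansion G s) A"
  shows "maximal_indep_set G (fst ` A) \<and> card (fst ` A) = card A"
proof
  have sub: "A \<subseteq> verts (graph_expansion G s)"
    and ind: "\<And>p q. p \<in> A \<Longrightarrow> q \<in> A \<Longrightarrow> \<not> p \<rightarrow>\<^bsub>graph_expansion G s\<^esub> q"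
    using A by (auto simp: maximal_indep_set_def indep_set_def)
  have sep: "p = q \<or> \<not> fst p \<rightarrow>\<^bsub>G\<^esub> fst q \<and> fst p \<noteq> fst q" if "p \<in> A" "q \<in> A" for p q
    using ind[OF that] that sub unfolding dominates_graph_expansion_iff by blast
  have "inj_on fst A" using sep by (auto intro!: inj_onI)
  then show "card (fst ` A) = card A" by (rule card_image)
  have "indep_set G (fst ` A)"
    using sub sep graph_not_dominates_self[OF G]
    unfolding indep_set_def verts_graph_expansion subset_iff by blast
  moreover have "\<exists>u\<in>fst ` A. u \<rightarrow>\<^bsub>G\<^esub> v" if v: "v \<in> verts G - fst ` A" for v
  proof -
    \<comment> \<open>Positive multiplicity provides the copy \<open>(v, 1)\<close>. Its neighbour
      in \<open>A\<close> is not a copy of \<open>v\<close>, so their adjacency comes from an edge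
      of \<open>G\<close>.\<close>
    have "(v, 1) \<in> verts (graph_expansion G s) - A"
      using v s by (force simp: verts_graph_expansion)
    then obtain p where p: "p \<in> A" "p \<rightarrow>\<^bsub>graph_expansion G s\<^esub> (v, 1)"
      using A maximal_indep_set_iff[OF graph_graph_expansion[OF G]] by blast
    then have "fst p \<noteq> v" using v by blast
    then show ?thesis using p by (auto simp: dominates_graph_expansion_iff)
  qed
  ultimately show "maximal_indep_set G (fst ` A)"
    using maximal_indep_set_iff[OF G] by blast
qed

lemma well_covered_graph_expansion:
  assumes "graph G" "well_covered G" "\<And>x. x \<in> verts G \<Longrightarrow> s x \<ge> 1"
  shows "well_covered (graph_expansion G s)"
  unfolding well_covered_def
proof (intro allI impI, elim conjE)
  fix A B
  assume "maximal_indep_set (graph_expansion G s) A" "maximal_indep_set (graph_expansion G s) B"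
  note maximal_indep_set_graph_expansion[where s = s, OF assms(1,3) this(1)]
    maximal_indep_set_graph_expansion[where s = s, OF assms(1,3) this(2)]
  moreover from this have "card (fst ` A) = card (fst ` B)"
    using assms(2) unfolding well_covered_def by blast
  ultimately show "card A = card B" by simp
qed

section \<open>Vertex decomposability and shedding vertices of expansions\<close>

lemma vertex_decomposable_imp_well_covered:
  "vertex_decomposable G \<Longrightarrow> well_covered G"
  by (induction rule: vertex_decomposable.induct) auto

lemma vertex_decomposable_graph_expansion:
  assumes "graph G" "vertex_decomposable G" "\<And>x. x \<in> verts G \<Longrightarrow> s x \<ge> 1"
  shows "vertex_decomposable (graph_expansion G s)"
  using assms
proof (induction "card (verts (graph_expansion G s))" arbitrary: G s rule: less_induct)
  case less
  note G = \<open>graph G\<close> and vd = \<open>vertex_decomposable G\<close> and s = less.prems(3)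
  let ?E = "graph_expansion G s"
  have gE: "graph ?E" by (rule graph_graph_expansion[OF G])
  have wc: "well_covered ?E"
    by (intro well_covered_graph_expansion G vertex_decomposable_imp_well_covered vd s)
  have smaller: "card (verts H) < card (verts ?E)"
    if "verts H = verts ?E - X" "p \<in> X" "p \<in> verts ?E" for H :: "('a \<times> nat, 'c) pre_digraph" and X p
    using that graph_finite_verts[OF gE] by (auto intro!: psubset_card_mono)
  \<comment> \<open>Available for every vertex of the expansion, since \<open>G - N[x]\<close> is
    vertex decomposable for every \<open>x\<close>; below, only the deletion of a single vertex
    remains to be checked.\<close>
  have link: "vertex_decomposable (del_closed_nbhd ?E (x, j))" if p: "(x, j) \<in> verts ?E" for x j
  proof -
    have x: "x \<in> verts G" using p by (simp add: verts_graph_expansion)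
    have eq: "del_closed_nbhd ?E (x, j) = graph_expansion (del_closed_nbhd G x) s"
      by (rule del_closed_nbhd_graph_expansion[OF G p])
    have "card (verts (del_closed_nbhd ?E (x, j))) < card (verts ?E)"
      by (rule smaller[OF _ _ p]) (auto simp: del_closed_nbhd_def closed_nbhd_def)
    then show ?thesis
      unfolding eq
    proof (rule less.hyps)
      show "graph (del_closed_nbhd G x)" by (rule graph_del_closed_nbhd[OF G])
      show "vertex_decomposable (del_closed_nbhd G x)"
        by (rule vertex_decomposable_del_closed_nbhd[OF vd G x])
      show "s y \<ge> 1" if "y \<in> verts (del_closed_nbhd G x)" for y
        using that s by (simp add: del_closed_nbhd_def)
    qed
  qed
  have del: "card (verts (pre_digraph.del_vert ?E p)) < card (verts ?E)" if "p \<in> verts ?E" for p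
    by (rule smaller[OF _ _ that]) (auto simp: pre_digraph.verts_del_vert)
  show ?case
  proof (cases "\<exists>x\<in>verts G. s x \<noteq> 1")
    case True
    then obtain x where x: "x \<in> verts G" "s x \<noteq> 1" by blast
    then have sx: "s x \<ge> 2" using s[OF x(1)] by linarith
    have p: "(x, s x) \<in> verts ?E" using x sx by (simp add: verts_graph_expansion)
    have eq: "pre_digraph.del_vert ?E (x, s x) = graph_expansion G (s(x := s x - 1))"
      by (rule del_vert_graph_expansion_last) (use G x sx in auto)
    \<comment> \<open>The base graph stays fixed and the lowered multiplicity is still at least one,
      so the induction hypothesis applies.\<close>
    have "vertex_decomposable (pre_digraph.del_vert ?E (x, s x))"
      using del[OF p] unfolding eq by (rule less.hyps) (use G vd s sx in auto)
    then show ?thesis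
      by (rule vertex_decomposable.shedding[OF wc p _ link[OF p]])
  next
    case one: False
    from vd show ?thesis
    proof cases
      case no_edges
      then have "\<not> x \<rightarrow>\<^bsub>G\<^esub> y" for x y by (auto simp: arcs_ends_def)
      \<comment> \<open>With single copies, distinct vertices of the expansion lie over distinct
        vertices of \<open>G\<close>, so no arcs arise inside a clique of copies.\<close>
      then have "arcs ?E = {}"
        using one by (auto simp: graph_expansion_def expansion_verts_def)
      with wc show ?thesis by (rule vertex_decomposable.no_edges)
    next
      case (shedding x)
      have p: "(x, 1) \<in> verts ?E" using shedding one by (auto simp: verts_graph_expansion)
      have eq: "pre_digraph.del_vert ?E (x, 1) = graph_expansion (pre_digraph.del_vert G x) s"
        by (rule del_vert_graph_expansion_only) (use G shedding one in auto)
      have "vertex_decomposable (pre_digraph.del_vert ?E (x, 1))"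
        using del[OF p] unfolding eq
        by (rule less.hyps) (use G graph_del_vert shedding s in \<open>auto simp: pre_digraph.verts_del_vert\<close>)
      then show ?thesis
        by (rule vertex_decomposable.shedding[OF wc p _ link[OF p]])
    qed
  qed
qed

theorem theorem7p2:
  fixes G :: "('a, 'b) pre_digraph" and s :: "'a \<Rightarrow> nat"
  assumes "graph G"
    and "vertex_decomposable G"
    and "\<And>x. x \<in> verts G \<Longrightarrow> s x \<ge> 2"
  shows "vertex_decomposable (graph_expansion G s) \<and>
    dominating_set (graph_expansion G s) (Shed (graph_expansion G s))"
proof
  let ?E = "graph_expansion G s"
  have s1: "s x \<ge> 1" if "x \<in> verts G" for x using assms(3)[OF that] by linarith
  show vdE: "vertex_decomposable ?E"
    by (rule vertex_decomposable_graph_expansion[OF assms(1,2) s1])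
  have last: "(x, s x) \<in> Shed ?E" if x: "x \<in> verts G" for x
  proof -
    have p: "(x, s x) \<in> verts ?E" using x s1 by (simp add: verts_graph_expansion)
    \<comment> \<open>The bound \<open>s x \<ge> 2\<close> keeps the lowered multiplicity
      positive.\<close>
    have "vertex_decomposable (graph_expansion G (s(x := s x - 1)))"
      by (rule vertex_decomposable_graph_expansion[OF assms(1,2)])
        (use s1 assms(3) x in \<open>fastforce simp: fun_upd_def\<close>)
    then have "vertex_decomposable (pre_digraph.del_vert ?E (x, s x))"
      using del_vert_graph_expansion_last[of G x s] assms(1) x s1[OF x] by simp
    with p show ?thesis
      using vertex_decomposable_del_closed_nbhd[OF vdE graph_graph_expansion[OF assms(1)] p]
      by (simp add: Shed_def)
  qed
  show "dominating_set ?E (Shed ?E)"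
    unfolding dominating_set_def
  proof (intro conjI ballI)
    show "Shed ?E \<subseteq> verts ?E" by (auto simp: Shed_def)
    fix p assume p: "p \<in> verts ?E - Shed ?E"
    then have x: "fst p \<in> verts G" by (simp add: verts_graph_expansion)
    \<comment> \<open>A vertex outside \<open>Shed ?E\<close> is not a last copy, hence is adjacent
      to the last copy in its own clique.\<close>
    have "p \<noteq> (fst p, s (fst p))" using p last[OF x] by auto
    then have "p \<rightarrow>\<^bsub>?E\<^esub> (fst p, s (fst p))"
      using p x s1[OF x] by (auto simp: dominates_graph_expansion_iff verts_graph_expansion)
    then show "\<exists>u\<in>Shed ?E. p \<rightarrow>\<^bsub>?E\<^esub> u" using last[OF x] by blast
  qed
qed

end
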